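(* Let $L$ be the group of automorphisms of the binary rooted tree generated by the automorphisms $a,b,c,d,x$ defined by: $a$ permutes the two vertices of the first level (with trivial sections), $b=(a,c)$, $c=(a,d)$, $d=(1,b)$, $x=(1,x)a$. Then $L$ is a (geometrically) branch group, it is contracting, and it admits an epimorphism onto $\mathbb{Z}$.
   Context: Let $\mathcal{T}$ be the binary rooted tree whose vertices are the finite sequences of $0,1$, with root $\emptyset$; $\mathcal{T}_v$ is the subtree of sequences with prefix $v$, canonically identified with $\mathcal{T}$ by deleting the prefix $v$. Every $g\in\mathrm{Aut}(\mathcal{T})$ is written $g=(g_0,g_1)\alpha$, where $\alpha\in\{1,a\}$ describes the action of $g$ on the first level and $g_0,g_1\in \mathrm{Aut}(\mathcal{T})$ are its sections at the vertices $0,1$. Products are read from left to right, so $g$ sends $iw$ to $\alpha(i)\,g_i(w)$, and $a(g_0,g_1)=(g_1,g_0)a$. When $\alpha$ is trivial we write $g=(g_0,g_1)$. Explicitly, $a(0w)=1w$, $a(1w)=0w$; $b(0w)=0a(w)$, $b(1w)=1c(w)$; $c(0w)=0a(w)$, $c(1w)=1d(w)$; $d(0w)=0w$, $d(1w)=1b(w)$; $x(0w)=1w$, $x(1w)=0x(w)$. Geometrically branch: for a group $\mathcal{G}$ acting on $\mathcal{T}$ by automorphisms, the rigid stabilizer of a vertex $v$ is the subgroup of elements acting trivially on $\mathcal{T}\setminus\mathcal{T}_v$, and $rist_{\mathcal{G}}(n)$ is the group generated by the rigid stabilizers of all vertices of level $n$. The action is geometrically branch if it is faithful, transitive on each level,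 and $rist_{\mathcal{G}}(n)$ has finite index in $\mathcal{G}$ for every $n$. Contracting: a self-similar group $\mathcal{G}\le \mathrm{Aut}(\mathcal{T})$ (one such that all sections of its elements belong to $\mathcal{G}$) is contracting if there is a finite set $\mathcal{N}\subset\mathcal{G}$ such that for every $g\in\mathcal{G}$ there is $k$ such that the section of $g$ at every vertex of level at least $k$ belongs to $\mathcal{N}$. *)

theory Defs
  imports "HOL-Algebra.Algebra" "HOL-Library.Sublist"
begin

(* Vertices are finite words over the alphabet {0,1}: False is the letter 0, True is the letter 1. *)
type_synonym vertex = "bool list"

definition tree_adj :: "vertex \<Rightarrow> vertex \<Rightarrow> bool" where
  "tree_adj v w \<longleftrightarrow> (\<exists>i. w = v @ [i]) \<or> (\<exists>i. v = w @ [i])"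

definition tree_aut :: "(vertex \<Rightarrow> vertex) \<Rightarrow> bool" where
  "tree_aut g \<longleftrightarrow> bij g \<and> g [] = [] \<and> (\<forall>v w. tree_adj (g v) (g w) \<longleftrightarrow> tree_adj v w)"

(* Products are read from left to right: in the product of g and h, g acts first. *)
definition Aut_T :: "(vertex \<Rightarrow> vertex) monoid" where
  "Aut_T = \<lparr>carrier = {g. tree_aut g}, monoid.mult = (\<lambda>g h. h \<circ> g), one = id\<rparr>"

(* The section g_v is determined by g (v @ w) = g v @ g_v w; note that g v has length |v|. *)
definition section_at :: "(vertex \<Rightarrow> vertex) \<Rightarrow> vertex \<Rightarrow> (vertex \<Rightarrow> vertex)" where
  "section_at g v = (\<lambda>w. drop (length v) (g (v @ w)))"

definition self_similar :: "(vertex \<Rightarrow> vertex) set \<Rightarrow> bool" where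
  "self_similar G \<longleftrightarrow> subgroup G Aut_T \<and> (\<forall>g\<in>G. \<forall>v. section_at g v \<in> G)"

definition contracting :: "(vertex \<Rightarrow> vertex) set \<Rightarrow> bool" where
  "contracting G \<longleftrightarrow> self_similar G \<and>
     (\<exists>N. finite N \<and> N \<subseteq> G \<and>
        (\<forall>g\<in>G. \<exists>k. \<forall>v. k \<le> length v \<longrightarrow> section_at g v \<in> N))"

(* An action of a group G on the tree by automorphisms is a homomorphism phi from G to Aut_T
   (a right action, in view of the order of multiplication in Aut_T). *)

definition rist :: "('g, 'm) monoid_scheme \<Rightarrow> ('g \<Rightarrow> vertex \<Rightarrow> vertex) \<Rightarrow> vertex \<Rightarrow> 'g set" where
  "rist G \<phi> v = {g \<in> carrier G. \<forall>w. \<not> prefix v w \<longrightarrow> \<phi> g w = w}"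

definition rist_level :: "('g, 'm) monoid_scheme \<Rightarrow> ('g \<Rightarrow> vertex \<Rightarrow> vertex) \<Rightarrow> nat \<Rightarrow> 'g set" where
  "rist_level G \<phi> n = generate G (\<Union>v\<in>{v. length v = n}. rist G \<phi> v)"

definition geometrically_branch ::
  "('g, 'm) monoid_scheme \<Rightarrow> ('g \<Rightarrow> vertex \<Rightarrow> vertex) \<Rightarrow> bool" where
  "geometrically_branch G \<phi> \<longleftrightarrow>
     group G \<and> \<phi> \<in> hom G Aut_T \<and>
     inj_on \<phi> (carrier G) \<and>
     (\<forall>v w. length v = length w \<longrightarrow> (\<exists>g\<in>carrier G. \<phi> g v = w)) \<and>
     (\<forall>n. finite (rcosets\<^bsub>G\<^esub> (rist_level G \<phi> n)))"

fun aut_a :: "vertex \<Rightarrow> vertex" where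
  "aut_a [] = []"
| "aut_a (False # w) = True # w"
| "aut_a (True # w) = False # w"

fun aut_b :: "vertex \<Rightarrow> vertex" and aut_c :: "vertex \<Rightarrow> vertex" and aut_d :: "vertex \<Rightarrow> vertex" where
  "aut_b [] = []"
| "aut_b (False # w) = False # aut_a w"
| "aut_b (True # w) = True # aut_c w"
| "aut_c [] = []"
| "aut_c (False # w) = False # aut_a w"
| "aut_c (True # w) = True # aut_d w"
| "aut_d [] = []"
| "aut_d (False # w) = False # w"
| "aut_d (True # w) = True # aut_b w"

fun aut_x :: "vertex \<Rightarrow> vertex" where
  "aut_x [] = []"
| "aut_x (False # w) = True # w"
| "aut_x (True # w) = False # aut_x w"

definition L :: "(vertex \<Rightarrow> vertex) monoid" where
  "L = Aut_T\<lparr>carrier := generate Aut_T {aut_a, aut_b, aut_c, aut_d, aut_x}\<rparr>"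

end

theory Submission
  imports Defs
begin

text \<open>
  Everything is computed with words in the letters \<open>a, b, c, d, x, x\<^sup>-\<^sup>1\<close>, read from left to right.
  A word has a section word at each vertex, one or no letter for each of its letters, and the
  exponent sum of \<open>x\<close> in a word is the sum of the exponent sums of its two sections at the first
  level, because \<open>x = (1, x)a\<close>.

  Contraction and the map onto the integers come from one finite computation. Let the nucleus
  consist of \<open>a\<close> and the elements \<open>x\<^sup>-\<^sup>i y x\<^sup>j\<close> with \<open>i, j \<in> {0, 1}\<close> and \<open>y \<in> {1, b, c, d}\<close>. It is
  closed under sections, and when a nucleus word is followed by one letter, all sections at level
  three are again nucleus words up to the relations \<open>a\<^sup>2 = b\<^sup>2 = c\<^sup>2 = d\<^sup>2 = bcd = x x\<^sup>-\<^sup>1 = 1\<close>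
  (\<open>settles_nucleus_letter\<close>). By induction on its length every word reaches the nucleus at some level
  (\<open>all_words_contract\<close>), so the group is contracting. All these relations preserve the exponent
  of \<open>x\<close>. If a word is trivial in the group, then so are all its sections; deep enough they are
  nucleus words that fix the first level, and these have exponent zero. Summing over the level, the
  word itself has exponent zero. So the exponent is a well-defined homomorphism onto the integers.

  For the branch property, consider at a vertex \<open>v\<close> the subgroup of those \<open>h\<close> for which the
  automorphism acting as \<open>h\<close> below \<open>v\<close> and trivially elsewhere lies in the group. At the vertex
  \<open>1\<close> it contains \<open>b\<close> and \<open>x\<close>, since \<open>d = (1, b)\<close> and \<open>xa = (1, x)\<close>, and it is normal, since
  the stabilizer of the first level projects onto the whole group. Modulo \<open>b\<close> and \<open>x\<close> the group
  is generated by the involutions \<open>a\<close> and \<open>d = c\<close> with \<open>(ad)\<^sup>4 = 1\<close>; so the subgroup has index at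
  most eight. For deeper vertices its index is still finite because the preimage of a subgroup of
  finite index under a homomorphism has finite index (\<open>finite_index_plantable\<close>). Finally, an element is
  determined modulo the rigid stabilizer of a level by its action on that level and by the cosets of its
  sections with respect to these subgroups, which leaves finitely many possibilities.
\<close>
section \<open>Words in the generators\<close>

datatype letter = Ga | Gb | Gc | Gd | Gx | Gxi

type_synonym word = "letter list"

fun aut_xi :: "vertex \<Rightarrow> vertex" where
  "aut_xi [] = []"
| "aut_xi (False # w) = True # aut_xi w"
| "aut_xi (True # w) = False # w"

fun letter_act :: "letter \<Rightarrow> vertex \<Rightarrow> vertex" where
  "letter_act Ga = aut_a"
| "letter_act Gb = aut_b"
| "letter_act Gc = aut_c"
| "letter_act Gd = aut_d"
| "letter_act Gx = aut_x"
| "letter_act Gxi = aut_xi"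

fun eval :: "word \<Rightarrow> vertex \<Rightarrow> vertex" where
  "eval [] w = w"
| "eval (s # u) w = eval u (letter_act s w)"

fun swaps :: "letter \<Rightarrow> bool" where
  "swaps Ga = True"
| "swaps Gx = True"
| "swaps Gxi = True"
| "swaps _ = False"

fun letter_sec :: "letter \<Rightarrow> bool \<Rightarrow> word" where
  "letter_sec Ga i = []"
| "letter_sec Gb i = (if i then [Gc] else [Ga])"
| "letter_sec Gc i = (if i then [Gd] else [Ga])"
| "letter_sec Gd i = (if i then [Gb] else [])"
| "letter_sec Gx i = (if i then [Gx] else [])"
| "letter_sec Gxi i = (if i then [] else [Gxi])"

fun sec :: "bool \<Rightarrow> word \<Rightarrow> word" where
  "sec i [] = []"
| "sec i (s # u) = letter_sec s i @ sec (i \<noteq> swaps s) u"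

fun flips :: "word \<Rightarrow> bool" where
  "flips [] = False"
| "flips (s # u) = (swaps s \<noteq> flips u)"

fun secs :: "vertex \<Rightarrow> word \<Rightarrow> word" where
  "secs [] u = u"
| "secs (i # v) u = secs v (sec i u)"

fun letter_inv :: "letter \<Rightarrow> letter" where
  "letter_inv Gx = Gxi"
| "letter_inv Gxi = Gx"
| "letter_inv s = s"

definition word_inv :: "word \<Rightarrow> word" where
  "word_inv u = rev (map letter_inv u)"

fun exponent :: "word \<Rightarrow> int" where
  "exponent [] = 0"
| "exponent (s # u) = (case s of Gx \<Rightarrow> 1 | Gxi \<Rightarrow> -1 | _ \<Rightarrow> 0) + exponent u"

lemma eval_append [simp]: "eval (u @ v) w = eval v (eval u w)"
  by (induction u arbitrary: w) auto

lemma eval_Nil_vertex [simp]: "eval u [] = []"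
proof (induction u)
  case (Cons s u)
  then show ?case by (cases s) auto
qed simp

lemma letter_act_Cons: "letter_act s (i # w) = (i \<noteq> swaps s) # eval (letter_sec s i) w"
  by (cases s; cases i) auto

lemma eval_Cons: "eval u (i # w) = (i \<noteq> flips u) # eval (sec i u) w"
  by (induction u arbitrary: i w) (auto simp: letter_act_Cons)

lemma eval_vertex_append: "eval u (v @ w) = eval u v @ eval (secs v u) w"
  by (induction v arbitrary: u) (auto simp: eval_Cons)

lemma length_eval [simp]: "length (eval u v) = length v"
  by (induction v arbitrary: u) (auto simp: eval_Cons)

lemma section_at_eval: "section_at (eval u) v = eval (secs v u)"
  by (rule ext) (simp add: section_at_def eval_vertex_append)

lemma sec_append: "sec i (u @ v) = sec i u @ sec (i \<noteq> flips u) v"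
proof (induction u arbitrary: i)
  case (Cons s u)
  have "((i \<noteq> swaps s) \<noteq> flips u) = (i \<noteq> flips (s # u))" by auto
  then show ?case using Cons by simp
qed simp

lemma exponent_append [simp]: "exponent (u @ v) = exponent u + exponent v"
  by (induction u) auto

lemma exponent_letter_sec:
  "exponent (letter_sec s False) + exponent (letter_sec s True) = exponent [s]"
  by (cases s) auto

text \<open>Each letter \<open>x\<close> or \<open>x\<^sup>-\<^sup>1\<close> is passed on to exactly one of the two sections. For other letters the
  sections contain no \<open>x\<close>.\<close>
lemma exponent_sec: "exponent (sec False u) + exponent (sec True u) = exponent u"
proof (induction u)
  case (Cons s u)
  then show ?case using exponent_letter_sec[of s] by (cases "swaps s") auto
qed simp

lemma aut_a_aut_a [simp]: "aut_a (aut_a w) = w"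
  by (induction w rule: aut_a.induct) auto

text \<open>The sections of a relation between \<open>b, c, d\<close> are again such relations or
  trivial statements about \<open>a\<close>, so all nine have to be proved in one induction.\<close>
lemma Klein_four:
  shows aut_b_aut_b: "aut_b (aut_b w) = w" and aut_c_aut_c: "aut_c (aut_c w) = w"
    and aut_d_aut_d: "aut_d (aut_d w) = w"
    and aut_b_aut_c: "aut_b (aut_c w) = aut_d w" and aut_c_aut_b: "aut_c (aut_b w) = aut_d w"
    and aut_c_aut_d: "aut_c (aut_d w) = aut_b w" and aut_d_aut_c: "aut_d (aut_c w) = aut_b w"
    and aut_b_aut_d: "aut_b (aut_d w) = aut_c w" and aut_d_aut_b: "aut_d (aut_b w) = aut_c w"
proof (induction w)
  case (Cons i w)
  { case 1 show ?case using Cons by (cases i) auto }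
  { case 2 show ?case using Cons by (cases i) auto }
  { case 3 show ?case using Cons by (cases i) auto }
  { case 4 show ?case using Cons by (cases i) auto }
  { case 5 show ?case using Cons by (cases i) auto }
  { case 6 show ?case using Cons by (cases i) auto }
  { case 7 show ?case using Cons by (cases i) auto }
  { case 8 show ?case using Cons by (cases i) auto }
  { case 9 show ?case using Cons by (cases i) auto }
qed auto

lemma aut_x_aut_xi [simp]: "aut_x (aut_xi w) = w"
  by (induction w rule: aut_xi.induct) auto

lemma aut_xi_aut_x [simp]: "aut_xi (aut_x w) = w"
  by (induction w rule: aut_x.induct) auto

lemma letter_act_letter_inv [simp]: "letter_act (letter_inv s) (letter_act s w) = w"
  by (cases s) (auto simp: Klein_four)

lemma letter_inv_letter_inv [simp]: "letter_inv (letter_inv s) = s"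
  by (cases s) auto

lemma word_inv_word_inv [simp]: "word_inv (word_inv u) = u"
  by (simp add: word_inv_def rev_map comp_def)

lemma word_inv_append: "word_inv (u @ v) = word_inv v @ word_inv u"
  by (simp add: word_inv_def)

lemma eval_word_inv [simp]: "eval (word_inv u) (eval u w) = w"
  by (induction u arbitrary: w) (auto simp: word_inv_def)

lemma eval_word_inv' [simp]: "eval u (eval (word_inv u) w) = w"
  using eval_word_inv[of "word_inv u"] by simp

lemma exponent_word_inv [simp]: "exponent (word_inv u) = - exponent u"
proof (induction u)
  case (Cons s u)
  then show ?case by (cases s) (auto simp: word_inv_def)
qed (simp add: word_inv_def)

section \<open>Contraction\<close>

text \<open>Words are shortened only by relations that preserve the exponent of \<open>x\<close>.\<close>
fun push :: "letter \<Rightarrow> word \<Rightarrow> word" where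
  "push Ga (Ga # u) = u"
| "push Gb (Gb # u) = u"
| "push Gc (Gc # u) = u"
| "push Gd (Gd # u) = u"
| "push Gb (Gc # u) = Gd # u"
| "push Gc (Gb # u) = Gd # u"
| "push Gc (Gd # u) = Gb # u"
| "push Gd (Gc # u) = Gb # u"
| "push Gb (Gd # u) = Gc # u"
| "push Gd (Gb # u) = Gc # u"
| "push Gx (Gxi # u) = u"
| "push Gxi (Gx # u) = u"
| "push s u = s # u"

lemma eval_push [simp]: "eval (push s u) = eval (s # u)"
  by (rule ext, induction s u rule: push.induct) (auto simp: Klein_four)

lemma exponent_push [simp]: "exponent (push s u) = exponent (s # u)"
  by (induction s u rule: push.induct) auto

definition reduce :: "word \<Rightarrow> word" where
  "reduce u = foldr push u []"

lemma eval_reduce [simp]: "eval (reduce u) = eval u"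
  by (induction u) (auto simp: reduce_def)

lemma exponent_reduce [simp]: "exponent (reduce u) = exponent u"
  by (induction u) (auto simp: reduce_def)

text \<open>The letter \<open>a\<close> and the words \<open>x\<^sup>-\<^sup>i y x\<^sup>j\<close> with \<open>i, j \<in> {0, 1}\<close> and \<open>y\<close> in the four-group
  generated by \<open>b\<close> and \<open>c\<close>. No smaller set is closed in the way required: \<open>bx, cx, dx\<close> are sections of
  each other at the vertex \<open>1\<close>, and their inverses and \<open>x\<^sup>-\<^sup>1bx, x\<^sup>-\<^sup>1cx, x\<^sup>-\<^sup>1dx\<close> are so at the
  vertex \<open>0\<close>.\<close>
definition nucleus_words :: "word list" where
  "nucleus_words = [[], [Ga], [Gb], [Gc], [Gd], [Gx], [Gb, Gx], [Gc, Gx], [Gd, Gx],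
     [Gxi], [Gxi, Gb], [Gxi, Gc], [Gxi, Gd], [Gxi, Gb, Gx], [Gxi, Gc, Gx], [Gxi, Gd, Gx]]"

lemma nucleus_words_sec:
  "u \<in> set nucleus_words \<Longrightarrow> reduce (sec i u) \<in> set nucleus_words"
  by (cases i) (auto simp: nucleus_words_def reduce_def)

text \<open>A word contracts if iterated sections lead to nucleus words after finitely many levels, where at
  each stage a word may be replaced by one with the same action and the same exponent. Keeping the exponent
  in the rule \<open>same\<close> is what allows this predicate to serve both contraction and the homomorphism to the
  integers: that the exponent depends on the action only is a consequence of contraction.\<close>
inductive contracts :: "word \<Rightarrow> bool" where
  nucleus: "u \<in> set nucleus_words \<Longrightarrow> contracts u"
| same: "contracts u \<Longrightarrow> eval u = eval u' \<Longrightarrow> exponent u = exponent u' \<Longrightarrow> contracts u'"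
| sections: "contracts (sec False u) \<Longrightarrow> contracts (sec True u) \<Longrightarrow> contracts u"

text \<open>An executable sufficient condition for contraction within \<open>n\<close> levels.\<close>
fun settles :: "nat \<Rightarrow> word \<Rightarrow> bool" where
  "settles 0 u \<longleftrightarrow> reduce u \<in> set nucleus_words"
| "settles (Suc n) u \<longleftrightarrow> reduce u \<in> set nucleus_words \<or>
     settles n (sec False u) \<and> settles n (sec True u)"

lemma settles_contracts: "settles n u \<Longrightarrow> contracts u"
proof (induction n arbitrary: u)
  case 0
  then show ?case using contracts.nucleus contracts.same[of "reduce u" u] by simp
next
  case (Suc n)
  then show ?case using contracts.nucleus contracts.same[of "reduce u" u] contracts.sections
    by auto
qed

lemma settles_nucleus_letter:
  "\<forall>u\<in>set nucleus_words. \<forall>s\<in>set [Ga, Gb, Gc, Gd, Gx, Gxi]. settles 3 (u @ [s])"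
  by code_simp

lemma contracts_snoc_nucleus:
  "u \<in> set nucleus_words \<Longrightarrow> contracts (u @ [s])"
  using settles_nucleus_letter settles_contracts by (cases s) auto

lemma letter_sec_cases: "letter_sec s i = [] \<or> (\<exists>t. letter_sec s i = [t])"
  by (cases s) auto

text \<open>A section of \<open>us\<close> is a section of \<open>u\<close> followed by at most one letter, so the induction
  hypothesis applies to it. The finite computation enters only for \<open>u\<close> in the nucleus.\<close>
lemma contracts_snoc: "contracts u \<Longrightarrow> contracts (u @ [s])"
proof (induction u arbitrary: s rule: contracts.induct)
  case (nucleus u)
  then show ?case by (rule contracts_snoc_nucleus)
next
  case (same u u')
  have "eval (u @ [s]) = eval (u' @ [s])" using same.hyps by (auto simp: fun_eq_iff)
  then show ?case using contracts.same[OF same.IH] same.hyps by simp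
next
  case (sections u)
  have "contracts (sec i u @ letter_sec s j)" for i j
    using sections letter_sec_cases[of s j] by (cases i) auto
  then have "contracts (sec i (u @ [s]))" for i
    by (simp add: sec_append)
  then show ?case using contracts.sections by blast
qed

lemma all_words_contract: "contracts u"
proof (induction u rule: rev_induct)
  case Nil
  show ?case by (rule contracts.nucleus) (simp add: nucleus_words_def)
next
  case (snoc s u)
  then show ?case by (rule contracts_snoc)
qed

lemma eval_secs_cong: "eval u = eval u' \<Longrightarrow> eval (secs v u) = eval (secs v u')"
  by (metis section_at_eval)

lemma eval_sec_cong: "eval u = eval u' \<Longrightarrow> eval (sec i u) = eval (sec i u')"
  using eval_secs_cong[of u u' "[i]"] by simp

lemma nucleus_secs:
  "eval u \<in> eval ` set nucleus_words \<Longrightarrow> eval (secs v u) \<in> eval ` set nucleus_words"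
proof (induction v arbitrary: u)
  case (Cons i v)
  then obtain n where n: "n \<in> set nucleus_words" "eval u = eval n" by auto
  have "eval (sec i u) = eval (reduce (sec i n))" using eval_sec_cong[OF n(2)] by simp
  then have "eval (sec i u) \<in> eval ` set nucleus_words"
    using nucleus_words_sec[OF n(1), of i] by blast
  then show ?case using Cons.IH[of "sec i u"] by simp
qed simp

text \<open>Contraction of the group: the level \<open>k\<close> counts nested uses of the rule \<open>sections\<close> in
  the derivation of \<open>contracts u\<close>. Below the vertices where this derivation ends, the sections stay in the nucleus since it is closed under sections.\<close>
lemma eventually_nucleus:
  "\<exists>k. \<forall>v. k \<le> length v \<longrightarrow> eval (secs v u) \<in> eval ` set nucleus_words"
  using all_words_contract[of u]
proof (induction rule: contracts.induct)
  case (nucleus u)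
  then show ?case using nucleus_secs by blast
next
  case (same u u')
  then show ?case using eval_secs_cong by metis
next
  case (sections u)
  then obtain k l where
    k: "\<And>v. k \<le> length v \<Longrightarrow> eval (secs v (sec False u)) \<in> eval ` set nucleus_words" and
    l: "\<And>v. l \<le> length v \<Longrightarrow> eval (secs v (sec True u)) \<in> eval ` set nucleus_words"
    by metis
  have "eval (secs v u) \<in> eval ` set nucleus_words" if "Suc (max k l) \<le> length v" for v
    using that k l by (cases v; cases "hd v") auto
  then show ?case by blast
qed

section \<open>The exponent of the adding machine\<close>

lemma eval_id_flips: "eval u = id \<Longrightarrow> \<not> flips u"
  using eval_Cons[of u False "[]"] by (auto simp: fun_eq_iff)

lemma eval_id_sec: "eval u = id \<Longrightarrow> eval (sec i u) = id"
  using eval_Cons[of u i] by (auto simp: fun_eq_iff)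

text \<open>Nucleus words with nonzero exponent contain exactly one letter that moves the first level.\<close>
lemma nucleus_exponent: "u \<in> set nucleus_words \<Longrightarrow> \<not> flips u \<Longrightarrow> exponent u = 0"
  by (auto simp: nucleus_words_def)

text \<open>All sections of a trivial word are trivial, and the exponent is the sum of the exponents of the
  sections. So it suffices to look at trivial nucleus words.\<close>
lemma exponent_trivial_word: "eval u = id \<Longrightarrow> exponent u = 0"
  using all_words_contract[of u]
proof (induction rule: contracts.induct)
  case (nucleus u)
  then show ?case using eval_id_flips nucleus_exponent by blast
next
  case (sections u)
  then show ?case using eval_id_sec exponent_sec[of u] by (metis add.right_neutral)
qed auto

lemma exponent_well_defined:
  assumes "eval u = eval v"
  shows "exponent u = exponent v"
proof -
  have "eval (u @ word_inv v) = id" using assms by (auto simp: fun_eq_iff)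
  from exponent_trivial_word[OF this] show ?thesis by simp
qed

section \<open>The group L as the set of words\<close>

lemma tree_aut_comp: "tree_aut g \<Longrightarrow> tree_aut h \<Longrightarrow> tree_aut (h \<circ> g)"
  by (simp add: tree_aut_def bij_comp)

lemma tree_aut_inv:
  assumes "tree_aut g"
  shows "tree_aut (inv_into UNIV g)"
proof -
  have g: "bij g" "g [] = []" "\<And>v w. tree_adj (g v) (g w) \<longleftrightarrow> tree_adj v w"
    using assms by (auto simp: tree_aut_def)
  have "g (inv_into UNIV g v) = v" for v using g(1) by (simp add: bij_is_surj surj_f_inv_f)
  then have "tree_adj (inv_into UNIV g v) (inv_into UNIV g w) \<longleftrightarrow> tree_adj v w" for v w
    using g(3)[of "inv_into UNIV g v" "inv_into UNIV g w"] by simp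
  moreover have "inv_into UNIV g [] = []" using g(1,2) by (metis bij_inv_eq_iff)
  ultimately show ?thesis using g(1) by (simp add: tree_aut_def bij_imp_bij_inv)
qed

lemma group_Aut_T: "group Aut_T"
proof (rule groupI)
  fix g assume "g \<in> carrier Aut_T"
  then have g: "tree_aut g" by (simp add: Aut_T_def)
  then have "g \<circ> inv_into UNIV g = id"
    by (auto simp: tree_aut_def fun_eq_iff bij_is_surj surj_f_inv_f)
  then show "\<exists>h\<in>carrier Aut_T. h \<otimes>\<^bsub>Aut_T\<^esub> g = \<one>\<^bsub>Aut_T\<^esub>"
    using tree_aut_inv[OF g] by (auto simp: Aut_T_def)
qed (auto simp: Aut_T_def tree_aut_comp comp_assoc, simp add: tree_aut_def)

text \<open>A word sends each child of a vertex to a child of its image. Applying this to the inverse word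
  shows that being a child is also reflected.\<close>
lemma tree_aut_eval: "tree_aut (eval u)"
proof -
  have bij: "bij (eval u)"
    by (rule bijI[OF injI surjI[where f = "eval (word_inv u)"]])
      (metis eval_word_inv, simp)
  have child: "(\<exists>i. eval u w = eval u v @ [i]) \<longleftrightarrow> (\<exists>i. w = v @ [i])" for v w
  proof
    assume "\<exists>i. w = v @ [i]"
    then obtain i where i: "w = v @ [i]" by blast
    then have "eval u w = eval u v @ eval (secs v u) [i]" by (simp add: eval_vertex_append)
    then show "\<exists>i. eval u w = eval u v @ [i]" by (auto simp: eval_Cons)
  next
    assume "\<exists>i. eval u w = eval u v @ [i]"
    then obtain i where i: "eval u w = eval u v @ [i]" by blast
    have "w = eval (word_inv u) (eval u v @ [i])" using i by (metis eval_word_inv)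
    also have "\<dots> = v @ eval (secs (eval u v) (word_inv u)) [i]"
      by (simp add: eval_vertex_append)
    finally show "\<exists>i. w = v @ [i]" by (auto simp: eval_Cons)
  qed
  show ?thesis unfolding tree_aut_def tree_adj_def using bij child by simp
qed

lemma eval_in_Aut_T: "eval u \<in> carrier Aut_T"
  using tree_aut_eval by (simp add: Aut_T_def)

lemma mult_Aut_T [simp]: "g \<otimes>\<^bsub>Aut_T\<^esub> h = h \<circ> g"
  by (simp add: Aut_T_def)

lemma one_Aut_T [simp]: "\<one>\<^bsub>Aut_T\<^esub> = id"
  by (simp add: Aut_T_def)

lemma eval_Nil: "eval [] = id"
  by auto

lemma eval_append_comp: "eval (u @ v) = eval v \<circ> eval u"
  by auto

lemma inv_Aut_T_eval: "inv\<^bsub>Aut_T\<^esub> (eval u) = eval (word_inv u)"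
  by (rule group.inv_equality[OF group_Aut_T]) (auto simp: eval_in_Aut_T fun_eq_iff)

lemma eval_singleton: "eval [s] = letter_act s"
  by auto

lemma subgroup_range_eval: "subgroup (range eval) Aut_T"
proof (rule group.subgroupI[OF group_Aut_T])
  show "range eval \<subseteq> carrier Aut_T" using eval_in_Aut_T by auto
next
  fix g assume "g \<in> range eval"
  then show "inv\<^bsub>Aut_T\<^esub> g \<in> range eval" by (auto simp: inv_Aut_T_eval)
next
  fix g h assume "g \<in> range eval" "h \<in> range eval"
  then show "g \<otimes>\<^bsub>Aut_T\<^esub> h \<in> range eval" by (auto simp flip: eval_append_comp)
qed auto

lemma carrier_L: "carrier L = range eval"
proof
  let ?S = "{aut_a, aut_b, aut_c, aut_d, aut_x}"
  have "letter_act s \<in> range eval" for s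
    using eval_singleton by (metis rangeI)
  then have "?S \<subseteq> range eval"
    using letter_act.simps by (metis empty_subsetI insert_subset)
  then show "carrier L \<subseteq> range eval"
    using group.generate_subgroup_incl[OF group_Aut_T _ subgroup_range_eval]
    by (simp add: L_def)
  \<comment> \<open>Conversely, the letter \<open>x\<^sup>-\<^sup>1\<close> is available because generated subgroups contain inverses.\<close>
  have xi: "aut_xi = inv\<^bsub>Aut_T\<^esub> aut_x"
    using inv_Aut_T_eval[of "[Gx]"] by (simp add: eval_singleton word_inv_def)
  have letter: "letter_act s \<in> generate Aut_T ?S" for s
    by (cases s) (auto simp: xi intro: generate.incl generate.inv)
  have "eval u \<in> generate Aut_T ?S" for u
  proof (induction u rule: rev_induct)
    case Nil
    then show ?case using generate.one[of Aut_T ?S] by (simp only: eval_Nil one_Aut_T)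
  next
    case (snoc s u)
    then show ?case using generate.eng[OF snoc letter, of s]
      by (simp only: eval_append_comp eval_singleton mult_Aut_T)
  qed
  then show "range eval \<subseteq> carrier L" by (auto simp: L_def)
qed

lemma eval_in_L [simp]: "eval u \<in> carrier L"
  by (simp add: carrier_L)

lemma mult_L: "g \<otimes>\<^bsub>L\<^esub> h = h \<circ> g"
  by (simp add: L_def Aut_T_def)

lemma one_L: "\<one>\<^bsub>L\<^esub> = id"
  by (simp add: L_def Aut_T_def)

lemma L_eq: "L = Aut_T\<lparr>carrier := range eval\<rparr>"
  using carrier_L by (simp add: L_def)

interpretation L: group L
  unfolding L_eq by (rule group.subgroup_imp_group[OF group_Aut_T subgroup_range_eval])

lemma inv_L_eval: "inv\<^bsub>L\<^esub> (eval u) = eval (word_inv u)"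
  by (rule L.inv_equality) (auto simp: mult_L one_L fun_eq_iff)

lemma contracting_L: "contracting (carrier L)"
  unfolding contracting_def self_similar_def
proof (intro conjI exI[of _ "eval ` set nucleus_words"])
  show "subgroup (carrier L) Aut_T" using subgroup_range_eval by (simp add: carrier_L)
qed (use eventually_nucleus in \<open>auto simp: carrier_L section_at_eval\<close>)

section \<open>The homomorphism onto the integers\<close>

text \<open>By \<open>exponent_well_defined\<close> the choice of the word does not matter.\<close>
definition winding :: "(vertex \<Rightarrow> vertex) \<Rightarrow> int" where
  "winding g = exponent (SOME u. eval u = g)"

lemma winding_eval [simp]: "winding (eval u) = exponent u"
  unfolding winding_def by (rule exponent_well_defined) (rule someI, rule refl)

lemma exponent_replicate [simp]:
  "exponent (replicate n Gx) = int n" "exponent (replicate n Gxi) = - int n"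
  by (induction n) auto

lemma winding_epi: "winding \<in> epi L integer_group"
proof -
  have "winding \<in> hom L integer_group"
    by (auto simp: hom_def carrier_L mult_L simp flip: eval_append_comp)
  moreover have "\<exists>u. exponent u = n" for n
    using exponent_replicate[of "nat n"] exponent_replicate[of "nat (- n)"]
    by (cases "0 \<le> n") (metis int_nat_eq, metis add.inverse_inverse int_nat_eq neg_0_le_iff_le nle_le)
  then have "winding ` carrier L = carrier integer_group"
    by (auto simp: carrier_L image_iff) metis
  ultimately show ?thesis by (simp add: epi_def)
qed

section \<open>Subgroups of finite index\<close>

lemma (in group) finite_rcosetsI_transversal:
  assumes "subgroup H G" "finite T" "T \<subseteq> carrier G"
    and "\<And>g. g \<in> carrier G \<Longrightarrow> \<exists>t\<in>T. g \<otimes> inv t \<in> H"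
  shows "finite (rcosets H)"
proof -
  have "\<exists>t\<in>T. H #> g = H #> t" if g: "g \<in> carrier G" for g
  proof -
    obtain t where t: "t \<in> T" "g \<otimes> inv t \<in> H" using assms(4)[OF g] by blast
    then have "g = (g \<otimes> inv t) \<otimes> t" using g assms(3) by (auto simp: m_assoc)
    then have "g \<in> H #> t" using t by (auto simp: r_coset_def)
    then show ?thesis using repr_independence[OF _ _ assms(1)] t assms(3) by blast
  qed
  then have "rcosets H \<subseteq> (\<lambda>t. H #> t) ` T" by (auto simp: RCOSETS_def)
  then show ?thesis using assms(2) finite_surj by blast
qed

text \<open>It is often easier to name finitely many invariants that separate cosets than to exhibit a
  transversal; the converse for the canonical invariant, the coset itself, is
  \<open>rcoset_eq_imp_quotient_mem\<close>.\<close>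
lemma (in group) finite_rcosetsI_classifier:
  assumes "subgroup H G" "finite (F ` carrier G)"
    and "\<And>g h. g \<in> carrier G \<Longrightarrow> h \<in> carrier G \<Longrightarrow> F g = F h \<Longrightarrow> g \<otimes> inv h \<in> H"
  shows "finite (rcosets H)"
proof -
  define T where "T = inv_into (carrier G) F ` F ` carrier G"
  show ?thesis
  proof (rule finite_rcosetsI_transversal[OF assms(1)])
    show "finite T" using assms(2) by (simp add: T_def)
    show "T \<subseteq> carrier G" by (auto simp: T_def intro: inv_into_into)
    fix g assume g: "g \<in> carrier G"
    then have "g \<otimes> inv (inv_into (carrier G) F (F g)) \<in> H"
      by (intro assms(3)) (auto intro: inv_into_into simp: f_inv_into_f)
    then show "\<exists>t\<in>T. g \<otimes> inv t \<in> H" using g by (auto simp: T_def)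
  qed
qed

lemma (in group) rcoset_eq_imp_quotient_mem:
  assumes "subgroup H G" "g \<in> carrier G" "h \<in> carrier G" "H #> g = H #> h"
  shows "g \<otimes> inv h \<in> H"
proof -
  have "g \<in> H #> h" using rcos_self[OF assms(2,1)] assms(4) by simp
  then obtain k where "k \<in> H" "g = k \<otimes> h" by (auto simp: r_coset_def)
  then show ?thesis using assms subgroup.subset[OF assms(1)] by (auto simp: m_assoc)
qed

text \<open>An element \<open>g\<close> is classified by its coset \<open>Hg\<close> together with
  the coset of \<open>\<phi> (g r\<^sup>-\<^sup>1)\<close> modulo \<open>K\<close>, where \<open>r\<close> is a representative of \<open>Hg\<close> that depends on the coset only;
  for two elements of the same class the representatives cancel in the quotient.\<close>
lemma (in group) finite_rcosets_preimage:
  assumes H: "subgroup H G" "finite (rcosets H)"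
    and K: "subgroup K G" "finite (rcosets K)"
    and J: "subgroup J G" "\<And>h. h \<in> H \<Longrightarrow> \<phi> h \<in> K \<Longrightarrow> h \<in> J"
    and \<phi>: "\<phi> \<in> hom (G\<lparr>carrier := H\<rparr>) G"
  shows "finite (rcosets J)"
proof -
  define rep where "rep c = (SOME r. r \<in> carrier G \<and> H #> r = c)" for c
  have rep: "rep (H #> g) \<in> carrier G" "H #> rep (H #> g) = H #> g" if "g \<in> carrier G" for g
    using someI[of "\<lambda>r. r \<in> carrier G \<and> H #> r = H #> g" g] that
    unfolding rep_def by auto
  have in_H: "g \<otimes> inv (rep (H #> g)) \<in> H" if "g \<in> carrier G" for g
    using rcoset_eq_imp_quotient_mem[OF H(1) that rep(1)] rep that by simp
  have HG: "H \<subseteq> carrier G" using H(1) by (rule subgroup.subset)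
  have \<phi>_in: "\<phi> h \<in> carrier G" if "h \<in> H" for h
    using \<phi> that by (auto simp: hom_def)
  interpret \<phi>: group_hom "G\<lparr>carrier := H\<rparr>" G \<phi>
    using \<phi> subgroup_imp_group[OF H(1)]
    by (simp add: group_hom_def group_hom_axioms_def is_group)
  have \<phi>_quot: "\<phi> (h \<otimes> inv k) = \<phi> h \<otimes> inv (\<phi> k)" if "h \<in> H" "k \<in> H" for h k
    using \<phi>.hom_mult[of h "inv k"] \<phi>.hom_inv[of k] that H(1) m_inv_consistent[OF H(1)]
    by (simp add: subgroup.m_inv_closed)
  define F where "F g = (H #> g, K #> \<phi> (g \<otimes> inv (rep (H #> g))))" for g
  show ?thesis
  proof (rule finite_rcosetsI_classifier[OF J(1), of F])
    have "F ` carrier G \<subseteq> (rcosets H) \<times> (rcosets K)"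
      using rcosetsI[OF HG] rcosetsI[OF subgroup.subset[OF K(1)] \<phi>_in[OF in_H]]
      by (auto simp: F_def)
    then show "finite (F ` carrier G)" using H(2) K(2) finite_subset by blast
  next
    fix g h assume gh: "g \<in> carrier G" "h \<in> carrier G" "F g = F h"
    define r where "r = rep (H #> h)"
    have r: "r \<in> carrier G" using rep gh by (simp add: r_def)
    have eq: "H #> g = H #> h" "K #> \<phi> (g \<otimes> inv r) = K #> \<phi> (h \<otimes> inv r)"
      using gh(3) by (auto simp: F_def r_def)
    have mem: "g \<otimes> inv r \<in> H" "h \<otimes> inv r \<in> H"
      using in_H[OF gh(1)] in_H[OF gh(2)] eq by (auto simp: r_def)
    have "inv r \<otimes> (r \<otimes> inv h) = inv h"
      using gh r by (simp flip: m_assoc)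
    then have gh_eq: "(g \<otimes> inv r) \<otimes> inv (h \<otimes> inv r) = g \<otimes> inv h"
      using gh r by (simp add: inv_mult_group m_assoc)
    have "\<phi> (g \<otimes> inv h) \<in> K"
      using rcoset_eq_imp_quotient_mem[OF K(1) \<phi>_in \<phi>_in eq(2)] mem \<phi>_quot[OF mem] gh_eq
      by simp
    then show "g \<otimes> inv h \<in> J"
      using J(2) rcoset_eq_imp_quotient_mem[OF H(1) gh(1,2) eq(1)] by blast
  qed
qed

section \<open>Planting an automorphism at a vertex\<close>

text \<open>The automorphism that acts as \<open>h\<close> on the subtree below \<open>v\<close> and trivially elsewhere.\<close>
fun plant :: "vertex \<Rightarrow> (vertex \<Rightarrow> vertex) \<Rightarrow> vertex \<Rightarrow> vertex" where
  "plant [] h w = h w"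
| "plant (i # v) h [] = []"
| "plant (i # v) h (j # w) = j # (if i = j then plant v h w else w)"

lemma plant_Cons: "plant (i # v) h = plant [i] (plant v h)"
proof
  show "plant (i # v) h w = plant [i] (plant v h) w" for w by (cases w) auto
qed

lemma plant_append [simp]: "plant v h (v @ w) = v @ h w"
  by (induction v) auto

lemma plant_outside [simp]: "\<not> prefix v w \<Longrightarrow> plant v h w = w"
  by (induction v h w rule: plant.induct) auto

lemma plant_comp: "plant v (h \<circ> g) = plant v h \<circ> plant v g"
proof
  show "plant v (h \<circ> g) w = (plant v h \<circ> plant v g) w" for w
    by (induction v g w rule: plant.induct) auto
qed

lemma plant_id: "plant v id = id"
proof
  show "plant v id w = id w" for w
    by (induction v "id :: vertex \<Rightarrow> vertex" w rule: plant.induct) auto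
qed

text \<open>The projection of the rigid stabilizer of \<open>v\<close> to the subtree below \<open>v\<close>, as a subgroup of \<open>L\<close>.\<close>
definition plantable :: "vertex \<Rightarrow> (vertex \<Rightarrow> vertex) set" where
  "plantable v = {h \<in> carrier L. plant v h \<in> carrier L}"

lemma plant_eval_word_inv:
  assumes "plant v (eval u) = eval p"
  shows "plant v (eval (word_inv u)) = eval (word_inv p)"
proof
  fix w
  have "plant v (eval (word_inv u)) \<circ> eval p = plant v (eval (word_inv u) \<circ> eval u)"
    unfolding plant_comp assms ..
  also have "eval (word_inv u) \<circ> eval u = id" by auto
  finally have "plant v (eval (word_inv u)) \<circ> eval p = id" by (simp only: plant_id)
  then have "plant v (eval (word_inv u)) (eval p (eval (word_inv p) w)) = eval (word_inv p) w"
    by (metis comp_apply id_apply)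
  then show "plant v (eval (word_inv u)) w = eval (word_inv p) w" by simp
qed

lemma subgroup_plantable: "subgroup (plantable v) L"
proof (rule L.subgroupI)
  have "id \<in> carrier L" using L.one_closed by (simp add: one_L)
  then show "plantable v \<noteq> {}" by (auto simp: plantable_def plant_id)
next
  fix g assume "g \<in> plantable v"
  then obtain u p where "g = eval u" "plant v (eval u) = eval p"
    by (auto simp: plantable_def carrier_L)
  then show "inv\<^bsub>L\<^esub> g \<in> plantable v"
    using plant_eval_word_inv by (simp add: plantable_def inv_L_eval)
next
  fix g h assume "g \<in> plantable v" "h \<in> plantable v"
  then show "g \<otimes>\<^bsub>L\<^esub> h \<in> plantable v"
    using L.m_closed[of g h] L.m_closed[of "plant v g" "plant v h"]
    by (simp add: plantable_def mult_L plant_comp)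
qed (simp add: plantable_def)

lemma plant_hom: "plant v \<in> hom (L\<lparr>carrier := plantable v\<rparr>) L"
  by (auto simp: hom_def plantable_def mult_L plant_comp)

section \<open>The elements plantable at a vertex of the first level\<close>

text \<open>For every letter, a word that fixes the first level and has that letter as its section at the
  vertex \<open>1\<close>. It witnesses that the stabilizer of the first level projects onto \<open>L\<close>.\<close>
fun letter_lift :: "letter \<Rightarrow> word" where
  "letter_lift Ga = [Ga, Gb, Ga]"
| "letter_lift Gb = [Gd]"
| "letter_lift Gc = [Gb]"
| "letter_lift Gd = [Gc]"
| "letter_lift Gx = [Gx, Ga]"
| "letter_lift Gxi = [Ga, Gxi]"

definition lift :: "word \<Rightarrow> word" where
  "lift u = concat (map letter_lift u)"

lemma eval_lift [simp]: "eval (lift u) (True # w) = True # eval u w"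
proof (induction u arbitrary: w)
  case (Cons s u)
  then show ?case by (cases s) (auto simp: lift_def)
qed (simp add: lift_def)

lemma flips_lift: "\<not> flips (lift u)"
  using eval_lift[of u "[]"] by (simp add: eval_Cons)

lemma eval_word_inv_lift: "eval (word_inv (lift u)) (True # w) = True # eval (word_inv u) w"
  using eval_word_inv[of "lift u" "True # eval (word_inv u) w"] by simp

text \<open>Normality. Conjugating the planted \<open>h\<close> by a lift of \<open>u\<close> conjugates \<open>h\<close> by \<open>u\<close> below the vertex
  \<open>1\<close>, and does nothing below \<open>0\<close>, where the planted \<open>h\<close> is trivial.\<close>
lemma plantable_conj:
  assumes "h \<in> plantable [True]"
  shows "eval (word_inv u) \<circ> h \<circ> eval u \<in> plantable [True]"
proof -
  obtain t p where h: "h = eval t" and p: "plant [True] h = eval p"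
    using assms by (auto simp: plantable_def carrier_L)
  have "plant [True] (eval (word_inv u) \<circ> h \<circ> eval u) w
      = eval (lift u @ p @ word_inv (lift u)) w" for w
  proof (cases w)
    case (Cons j w')
    show ?thesis
    proof (cases j)
      case True
      then show ?thesis using Cons by (simp add: eval_word_inv_lift flip: p)
    next
      case False
      define z where "z = eval (sec False (lift u)) w'"
      have z: "eval (lift u) (False # w') = False # z"
        using flips_lift by (simp add: eval_Cons z_def)
      then have "eval (word_inv (lift u)) (False # z) = False # w'"
        by (metis eval_word_inv)
      then show ?thesis using False Cons z by (simp flip: p)
    qed
  qed simp
  then have "plant [True] (eval (word_inv u) \<circ> h \<circ> eval u)
      = eval (lift u @ p @ word_inv (lift u))" by blast
  moreover have "eval (word_inv u) \<circ> h \<circ> eval u = eval (u @ t @ word_inv u)"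
    by (auto simp: h)
  ultimately show ?thesis by (simp add: plantable_def)
qed

lemma plantable_b: "eval [Gb] \<in> plantable [True]"
proof -
  have "plant [True] (eval [Gb]) w = eval [Gd] w" for w
    by (cases w rule: aut_d.cases) auto
  then have "plant [True] (eval [Gb]) = eval [Gd]" by blast
  then show ?thesis by (simp only: plantable_def) simp
qed

lemma plantable_x: "eval [Gx] \<in> plantable [True]"
proof -
  have "plant [True] (eval [Gx]) w = eval [Gx, Ga] w" for w
    by (cases w rule: aut_d.cases) auto
  then have "plant [True] (eval [Gx]) = eval [Gx, Ga]" by blast
  then show ?thesis by (simp only: plantable_def) simp
qed

lemma plantable_Nil_word: "eval [] \<in> plantable v"
  using subgroup.one_closed[OF subgroup_plantable] by (simp only: one_L eval_Nil)

lemma plantable_xi: "eval [Gxi] \<in> plantable [True]"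
  using subgroup.m_inv_closed[OF subgroup_plantable plantable_x]
  by (simp only: inv_L_eval) (simp add: word_inv_def)

text \<open>The elements of the group generated by \<open>a\<close> and \<open>d\<close>, which is dihedral of order eight.\<close>
definition dihedral_words :: "word list" where
  "dihedral_words = [[], [Ga], [Gd], [Ga, Gd], [Gd, Ga], [Ga, Gd, Ga], [Gd, Ga, Gd], [Ga, Gd, Ga, Gd]]"

text \<open>This is \<open>(ad)\<^sup>4 = 1\<close>: since \<open>ad = (b, 1)a\<close>, the square of \<open>ad\<close> is the involution \<open>(b, b)\<close>.\<close>
lemma adad: "eval [Gd, Ga, Gd, Ga] = eval [Ga, Gd, Ga, Gd]"
proof
  show "eval [Gd, Ga, Gd, Ga] w = eval [Ga, Gd, Ga, Gd] w" for w
    by (cases w rule: aut_d.cases) auto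
qed

lemma dihedral_words_closed:
  assumes "t \<in> set dihedral_words" "s = Ga \<or> s = Gd"
  shows "\<exists>t'\<in>set dihedral_words. eval (t @ [s]) = eval t'"
proof -
  \<comment> \<open>In all but two cases, at most one cancellation of \<open>a\<^sup>2\<close> or \<open>d\<^sup>2\<close> is needed.\<close>
  have "reduce (t @ [s]) \<in> set dihedral_words \<or> t @ [s] = [Gd, Ga, Gd, Ga]
      \<or> t @ [s] = [Ga, Gd, Ga, Gd, Ga]"
    using assms by (auto simp: dihedral_words_def reduce_def)
  moreover have "eval [Ga, Gd, Ga, Gd, Ga] = eval [Gd, Ga, Gd]"
  proof
    fix w
    have "eval [Ga, Gd, Ga, Gd, Ga] w = eval [Gd, Ga, Gd, Ga] (aut_a w)" by simp
    also have "\<dots> = eval [Ga, Gd, Ga, Gd] (aut_a w)" by (simp only: adad)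
    finally show "eval [Ga, Gd, Ga, Gd, Ga] w = eval [Gd, Ga, Gd] w" by simp
  qed
  moreover have "[Gd, Ga, Gd] \<in> set dihedral_words" "[Ga, Gd, Ga, Gd] \<in> set dihedral_words"
    by (auto simp: dihedral_words_def)
  ultimately show ?thesis using adad eval_reduce by metis
qed

text \<open>Modulo \<open>b\<close> and \<open>x\<close> every letter is trivial or one of \<open>a\<close> and \<open>d\<close>; for \<open>c\<close> this is \<open>c = bd\<close>.\<close>
lemma letter_mod_plantable:
  "\<exists>r p. eval [s] = eval (r @ p) \<and> eval r \<in> plantable [True] \<and> p \<in> {[], [Ga], [Gd]}"
proof (cases s)
  case Gc
  have "eval [Gc] = eval ([Gb] @ [Gd])" by (auto simp: Klein_four)
  then show ?thesis using plantable_b unfolding Gc by blast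
next
  case Ga
  then show ?thesis using plantable_Nil_word by (metis append_Nil insertCI)
next
  case Gd
  then show ?thesis using plantable_Nil_word by (metis append_Nil insertCI)
next
  case Gb
  then show ?thesis using plantable_b by (metis append_Nil2 insertCI)
next
  case Gx
  then show ?thesis using plantable_x by (metis append_Nil2 insertCI)
next
  case Gxi
  then show ?thesis using plantable_xi by (metis append_Nil2 insertCI)
qed

text \<open>With \<open>t\<close> the representative of \<open>u\<close> and \<open>s = rp\<close> as above, \<open>us\<close> is represented by \<open>tp\<close>, since
  \<open>u s (tp)\<^sup>-\<^sup>1 = (u t\<^sup>-\<^sup>1) (t r t\<^sup>-\<^sup>1)\<close> and the second factor is a conjugate of \<open>r\<close>.\<close>
lemma word_mod_plantable:
  "\<exists>t\<in>set dihedral_words. eval (u @ word_inv t) \<in> plantable [True]"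
proof (induction u rule: rev_induct)
  case Nil
  have "[] \<in> set dihedral_words" by (simp add: dihedral_words_def)
  moreover have "eval ([] @ word_inv []) \<in> plantable [True]"
    using plantable_Nil_word by (simp add: word_inv_def)
  ultimately show ?case by blast
next
  case (snoc s u)
  then obtain t where t: "t \<in> set dihedral_words" "eval (u @ word_inv t) \<in> plantable [True]"
    by blast
  obtain r p where s: "eval [s] = eval (r @ p)" and r: "eval r \<in> plantable [True]"
    and p: "p \<in> {[], [Ga], [Gd]}"
    using letter_mod_plantable by blast
  obtain t' where t': "t' \<in> set dihedral_words" "eval (t @ p) = eval t'"
    using dihedral_words_closed[OF t(1)] p t(1) by auto
  have "eval (word_inv t') = inv\<^bsub>L\<^esub> eval (t @ p)" by (simp only: t'(2) inv_L_eval)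
  then have inv_t': "eval (word_inv t') = eval (word_inv p @ word_inv t)"
    by (simp only: inv_L_eval word_inv_append)
  have s': "eval [s] w = eval p (eval r w)" for w
    using s by (simp only: eval_append)
  have "eval ((u @ [s]) @ word_inv t')
      = (eval (word_inv t) \<circ> eval r \<circ> eval t) \<circ> eval (u @ word_inv t)"
    by (rule ext) (simp only: eval_append inv_t' s' eval_word_inv eval_word_inv' comp_apply)
  also have "\<dots> = eval (u @ word_inv t) \<otimes>\<^bsub>L\<^esub> (eval (word_inv t) \<circ> eval r \<circ> eval t)"
    by (simp only: mult_L)
  also have "\<dots> \<in> plantable [True]"
    by (rule subgroup.m_closed[OF subgroup_plantable t(2) plantable_conj[OF r]])
  finally show ?case using t'(1) by blast
qed

lemma finite_index_plantable_True: "finite (rcosets\<^bsub>L\<^esub> plantable [True])"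
proof (rule L.finite_rcosetsI_transversal[OF subgroup_plantable])
  fix g assume "g \<in> carrier L"
  then obtain u where u: "g = eval u" by (auto simp: carrier_L)
  obtain t where t: "t \<in> set dihedral_words" "eval (u @ word_inv t) \<in> plantable [True]"
    using word_mod_plantable by blast
  have "eval (u @ word_inv t) = g \<otimes>\<^bsub>L\<^esub> inv\<^bsub>L\<^esub> (eval t)"
    unfolding u inv_L_eval mult_L eval_append_comp ..
  then show "\<exists>t\<in>eval ` set dihedral_words. g \<otimes>\<^bsub>L\<^esub> inv\<^bsub>L\<^esub> t \<in> plantable [True]"
    using t by auto
qed auto

text \<open>Conjugation by \<open>a\<close> moves what is planted at the vertex \<open>1\<close> to the vertex \<open>0\<close>.\<close>
lemma plantable_False: "plantable [True] \<subseteq> plantable [False]"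
proof
  fix h assume "h \<in> plantable [True]"
  then obtain p where h: "h \<in> carrier L" "plant [True] h = eval p"
    by (auto simp: plantable_def carrier_L)
  have "plant [False] h w = eval ([Ga] @ p @ [Ga]) w" for w
    by (cases w rule: aut_a.cases) (auto simp flip: h(2))
  then have "plant [False] h = eval ([Ga] @ p @ [Ga])" by blast
  then show "h \<in> plantable [False]" using h(1) by (simp add: plantable_def)
qed

lemma finite_index_plantable_letter: "finite (rcosets\<^bsub>L\<^esub> plantable [i])"
proof (cases i)
  case True
  then show ?thesis using finite_index_plantable_True by simp
next
  case False
  have "finite (rcosets\<^bsub>L\<^esub> plantable [False])"
  proof (rule L.finite_rcosetsI_classifier[OF subgroup_plantable])
    show "finite ((\<lambda>g. plantable [True] #>\<^bsub>L\<^esub> g) ` carrier L)"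
      using finite_index_plantable_True by (simp add: RCOSETS_def image_UN[symmetric] UNION_singleton_eq_range)
  qed (use L.rcoset_eq_imp_quotient_mem[OF subgroup_plantable] plantable_False in blast)
  then show ?thesis using False by simp
qed

section \<open>Rigid stabilizers\<close>

text \<open>Planting at \<open>iv\<close> is planting at \<open>v\<close> and then planting the result at \<open>i\<close>. So the elements
  plantable at \<open>iv\<close> contain the preimage, under planting at \<open>v\<close>, of those plantable at \<open>i\<close>.\<close>
lemma finite_index_plantable: "finite (rcosets\<^bsub>L\<^esub> plantable v)"
proof (induction v)
  case Nil
  have "plant [] = (\<lambda>h. h)" by (intro ext) simp
  then have "plantable [] = carrier L" by (auto simp: plantable_def)
  then show ?case
    using L.finite_rcosetsI_transversal[OF subgroup_plantable, of "{\<one>\<^bsub>L\<^esub>}" "[]"] by simp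
next
  case (Cons i v)
  have "h \<in> plantable (i # v)" if "h \<in> plantable v" "plant v h \<in> plantable [i]" for h
    using that by (simp add: plantable_def plant_Cons[of i v])
  then show ?case
    using L.finite_rcosets_preimage[OF subgroup_plantable Cons.IH subgroup_plantable
        finite_index_plantable_letter subgroup_plantable _ plant_hom] by blast
qed

text \<open>A lift carries transitivity over from one level to the subtree below the vertex \<open>1\<close> at the next;
  \<open>a\<close> moves the first letter to \<open>1\<close> before and away from \<open>1\<close> after, when necessary.\<close>
lemma L_transitive:
  assumes "length v = length w"
  shows "\<exists>g\<in>carrier L. g v = w"
proof -
  have "\<exists>u. eval u v = w"
    using assms
  proof (induction v w rule: list_induct2)
    case (Cons i v j w)
    then obtain u where u: "eval u v = w" by blast
    let ?a = "\<lambda>i. if i then [] else [Ga]"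
    have "eval (?a i @ lift u @ ?a j) (i # v) = j # w"
      using u by (cases i; cases j) auto
    then show ?case by blast
  qed auto
  then show ?thesis using eval_in_L by blast
qed

lemma section_at_L:
  assumes "g \<in> carrier L"
  shows "section_at g v \<in> carrier L" "g (v @ w) = g v @ section_at g v w" "length (g v) = length v"
  using assms by (auto simp: carrier_L section_at_eval eval_vertex_append)

lemma section_at_mult:
  assumes "g \<in> carrier L" "h \<in> carrier L"
  shows "section_at (g \<otimes>\<^bsub>L\<^esub> h) v = section_at g v \<otimes>\<^bsub>L\<^esub> section_at h (g v)"
proof -
  have "(g \<otimes>\<^bsub>L\<^esub> h) (v @ w) = h (g v) @ section_at h (g v) (section_at g v w)" for w
    using section_at_L[OF assms(1)] section_at_L[OF assms(2)] by (simp add: mult_L)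
  then show ?thesis
    using section_at_L(3)[OF assms(1)] section_at_L(3)[OF assms(2)]
    by (intro ext) (simp add: section_at_def[of "h \<circ> g"] mult_L)
qed

lemma section_at_id [simp]: "section_at id v = id"
  by (auto simp: section_at_def)

lemma section_at_inv:
  assumes "g \<in> carrier L"
  shows "section_at (inv\<^bsub>L\<^esub> g) (g v) = inv\<^bsub>L\<^esub> (section_at g v)"
proof -
  have "section_at (g \<otimes>\<^bsub>L\<^esub> inv\<^bsub>L\<^esub> g) v = id"
    using L.r_inv[OF assms] by (simp only: one_L section_at_id)
  then have "section_at g v \<otimes>\<^bsub>L\<^esub> section_at (inv\<^bsub>L\<^esub> g) (g v) = \<one>\<^bsub>L\<^esub>"
    using section_at_mult[OF assms L.inv_closed[OF assms]] by (simp only: one_L)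
  then show ?thesis
    using L.inv_equality L.inv_inv section_at_L(1) L.inv_closed assms by metis
qed

lemma plant_in_rist:
  assumes "h \<in> plantable v"
  shows "plant v h \<in> rist L (\<lambda>g. g) v"
  using assms by (auto simp: rist_def plantable_def)

lemma plant_same_level:
  assumes "length w = length v"
  shows "plant v h (w @ z) = (if w = v then v @ h z else w @ z)"
proof (cases "w = v")
  case False
  then have "\<not> prefix v (w @ z)" using assms by (auto simp: prefix_def append_eq_append_conv)
  then show ?thesis using False by simp
qed simp

text \<open>Vertices above level \<open>n\<close> are extended to reach that level.\<close>
lemma trivial_sections_imp_id:
  assumes g: "g \<in> carrier L" "\<And>v. length v = n \<Longrightarrow> g v = v"
    and "\<And>v. length v = n \<Longrightarrow> section_at g v = id"
  shows "g = id"
proof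
  fix w
  have long: "g (v @ z) = v @ z" if "length v = n" for v z
    using section_at_L(2)[OF g(1), of v z] g(2) assms(3) that by simp
  define z where "z = w @ replicate n True"
  have "z = take n z @ drop n z" "length (take n z) = n"
    by (simp_all only: append_take_drop_id) (simp add: z_def)
  then have "g z = z" using long by metis
  then have "g w @ section_at g w (replicate n True) = w @ replicate n True"
    using section_at_L(2)[OF g(1)] by (simp add: z_def)
  then show "g w = id w" using section_at_L(3)[OF g(1)] by simp
qed

text \<open>An element that fixes level \<open>n\<close> is the product of its sections, planted at the vertices of that
  level. The set \<open>V\<close> collects the vertices whose sections have not yet been split off, which is the
  parameter of the induction.\<close>
lemma mem_rist_levelI:
  assumes "finite V" "V \<subseteq> {v. length v = n}" "g \<in> carrier L"
    and "\<And>v. length v = n \<Longrightarrow> g v = v"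
    and "\<And>v. v \<in> V \<Longrightarrow> section_at g v \<in> plantable v"
    and "\<And>v. length v = n \<Longrightarrow> v \<notin> V \<Longrightarrow> section_at g v = id"
  shows "g \<in> rist_level L (\<lambda>g. g) n"
  using assms
proof (induction V arbitrary: g rule: finite_induct)
  case empty
  then have "g = id" using trivial_sections_imp_id by blast
  then show ?case unfolding rist_level_def by (metis generate.one one_L)
next
  case (insert v V)
  let ?h = "section_at g v"
  have h: "?h \<in> plantable v" "?h \<in> carrier L" and v: "length v = n"
    using insert.prems by (auto simp: plantable_def)
  define q where "q = plant v ?h"
  have q: "q \<in> carrier L" using h by (simp add: q_def plantable_def)
  have q_eq: "q (w @ z) = (if w = v then v @ ?h z else w @ z)" if "length w = n" for w z
    using plant_same_level that v by (simp add: q_def)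
  \<comment> \<open>Splitting off the section at \<open>v\<close>: the quotient \<open>k\<close> has a trivial section there and agrees
    with \<open>g\<close> at the other vertices.\<close>
  define k where "k = inv\<^bsub>L\<^esub> q \<otimes>\<^bsub>L\<^esub> g"
  have k: "k \<in> carrier L" using q insert.prems(2) by (simp add: k_def)
  have qk: "g = q \<otimes>\<^bsub>L\<^esub> k"
    using q insert.prems(2) by (simp add: k_def L.m_assoc[symmetric])
  have h_one: "?h [] = []" using section_at_L(3)[OF h(2), of "[]"] by simp
  have q_level: "q w = w" if "length w = n" for w
    using q_eq[OF that, of "[]"] h_one by auto
  have k_level: "k w = w" if "length w = n" for w
    using insert.prems(3)[OF that] q_level[OF that] by (subst (asm) qk) (simp add: mult_L)
  have sec_q: "section_at q w = (if w = v then ?h else id)" if "length w = n" for w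
    by (rule ext) (use q_eq[OF that] that v in \<open>auto simp: section_at_def[of q]\<close>)
  have sec_g: "section_at g w = section_at q w \<otimes>\<^bsub>L\<^esub> section_at k w" if "length w = n" for w
    by (subst qk) (simp add: section_at_mult[OF q k] q_level[OF that])
  have sec_k_other: "section_at k w = section_at g w" if "length w = n" "w \<noteq> v" for w
    using sec_g[OF that(1)] sec_q[OF that(1)] that(2) by (simp add: mult_L)
  have sec_k_v: "section_at k v = id"
  proof -
    have "?h \<otimes>\<^bsub>L\<^esub> section_at k v = ?h" using sec_g[OF v] sec_q[OF v] by simp
    then have "?h \<otimes>\<^bsub>L\<^esub> section_at k v = ?h \<otimes>\<^bsub>L\<^esub> \<one>\<^bsub>L\<^esub>" using h(2) by simp
    then have "section_at k v = \<one>\<^bsub>L\<^esub>"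
      using L.l_cancel h(2) section_at_L(1)[OF k] L.one_closed by blast
    then show ?thesis by (simp only: one_L)
  qed
  have "k \<in> rist_level L (\<lambda>g. g) n"
  proof (rule insert.IH)
    show "V \<subseteq> {v. length v = n}" using insert.prems(1) by blast
    show "section_at k w \<in> plantable w" if "w \<in> V" for w
    proof -
      have "w \<noteq> v" "length w = n" using that insert.hyps(2) insert.prems(1) by auto
      then show ?thesis using insert.prems(4)[of w] that sec_k_other[of w] by simp
    qed
    show "section_at k w = id" if "length w = n" "w \<notin> V" for w
    proof (cases "w = v")
      case False
      then have "w \<notin> insert v V" using that(2) by blast
      then show ?thesis using insert.prems(5)[OF that(1)] sec_k_other[OF that(1) False] by metis
    qed (simp add: sec_k_v)
  qed (rule k, rule k_level)
  moreover have "q \<in> (\<Union>v\<in>{v. length v = n}. rist L (\<lambda>g. g) v)"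
    using plant_in_rist[OF h(1)] v by (auto simp: q_def)
  ultimately show ?case
    unfolding rist_level_def by (subst qk) (blast intro: generate.eng generate.incl)
qed

lemma subgroup_rist_level: "subgroup (rist_level L (\<lambda>g. g) n) L"
  unfolding rist_level_def by (rule L.generate_is_subgroup) (auto simp: rist_def)

text \<open>If \<open>g\<close> and \<open>h\<close> act alike on level \<open>n\<close>, then \<open>g h\<^sup>-\<^sup>1\<close> fixes that level and its section at \<open>v\<close> is
  \<open>g\<^sub>v h\<^sub>v\<^sup>-\<^sup>1\<close>. It is plantable at \<open>v\<close> if \<open>g\<^sub>v\<close> and \<open>h\<^sub>v\<close> lie in the same coset.\<close>
lemma finite_index_rist_level: "finite (rcosets\<^bsub>L\<^esub> rist_level L (\<lambda>g. g) n)"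
proof (rule L.finite_rcosetsI_classifier[OF subgroup_rist_level])
  let ?V = "{v :: vertex. length v = n}"
  let ?F = "\<lambda>g. \<lambda>v\<in>?V. (g v, plantable v #>\<^bsub>L\<^esub> section_at g v)"
  have fin: "finite ?V"
    using finite_lists_length_eq[of "UNIV :: bool set" n] by simp
  have "?F ` carrier L \<subseteq> (\<Pi>\<^sub>E v\<in>?V. ?V \<times> (rcosets\<^bsub>L\<^esub> plantable v))"
  proof (rule image_subsetI)
    fix g assume "g \<in> carrier L"
    then show "?F g \<in> (\<Pi>\<^sub>E v\<in>?V. ?V \<times> (rcosets\<^bsub>L\<^esub> plantable v))"
      using section_at_L L.rcosetsI[OF subgroup.subset[OF subgroup_plantable]]
      by (intro restrict_PiE_iff[THEN iffD2]) auto
  qed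
  moreover have "finite (\<Pi>\<^sub>E v\<in>?V. ?V \<times> (rcosets\<^bsub>L\<^esub> plantable v))"
    using fin finite_index_plantable by (intro finite_PiE) auto
  ultimately show "finite (?F ` carrier L)" by (rule finite_subset)
  fix g h assume g: "g \<in> carrier L" and h: "h \<in> carrier L" and eq: "?F g = ?F h"
  have same: "g v = h v" "plantable v #>\<^bsub>L\<^esub> section_at g v = plantable v #>\<^bsub>L\<^esub> section_at h v"
    if "length v = n" for v
    using fun_cong[OF eq, of v] that by auto
  have inv_h: "inv\<^bsub>L\<^esub> h \<in> carrier L" using h by simp
  show "g \<otimes>\<^bsub>L\<^esub> inv\<^bsub>L\<^esub> h \<in> rist_level L (\<lambda>g. g) n"
  proof (rule mem_rist_levelI[OF fin subset_refl])
    show "g \<otimes>\<^bsub>L\<^esub> inv\<^bsub>L\<^esub> h \<in> carrier L" using g inv_h by (rule L.m_closed)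
    fix v :: vertex
    show "(g \<otimes>\<^bsub>L\<^esub> inv\<^bsub>L\<^esub> h) v = v" if v: "length v = n"
    proof -
      have "(h \<otimes>\<^bsub>L\<^esub> inv\<^bsub>L\<^esub> h) v = v" using h by (simp add: one_L)
      then show ?thesis using same(1)[OF v] by (simp add: mult_L)
    qed
    show "section_at (g \<otimes>\<^bsub>L\<^esub> inv\<^bsub>L\<^esub> h) v \<in> plantable v" if "v \<in> ?V"
    proof -
      have v: "length v = n" using that by simp
      have "section_at (g \<otimes>\<^bsub>L\<^esub> inv\<^bsub>L\<^esub> h) v
          = section_at g v \<otimes>\<^bsub>L\<^esub> inv\<^bsub>L\<^esub> (section_at h v)"
        using section_at_mult[OF g inv_h] section_at_inv[OF h] same(1)[OF v] by simp
      then show ?thesis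
        using L.rcoset_eq_imp_quotient_mem[OF subgroup_plantable _ _ same(2)[OF v]]
          section_at_L(1) g h by simp
    qed
  qed auto
qed

lemma geometrically_branch_L: "geometrically_branch L (\<lambda>g. g)"
proof -
  have "(\<lambda>g. g) \<in> hom L Aut_T"
    using eval_in_Aut_T by (auto simp: hom_def carrier_L mult_L)
  then show ?thesis
    unfolding geometrically_branch_def
    using L.is_group L_transitive finite_index_rist_level by (auto simp: inj_on_def)
qed

theorem theorem2:
  shows "geometrically_branch L (\<lambda>g. g) \<and> contracting (carrier L) \<and>
         (\<exists>f. f \<in> epi L integer_group)"
  using geometrically_branch_L contracting_L winding_epi by blast

end
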